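(* Let $q\geq 2$ be an integer and let $p(x)\in\mathbb{Z}[x]$ have degree at least $2$ and positive leading coefficient. Then there exists an explicitly computable $\gamma>0$, depending only on $q$ and $p(x)$, such that $$\#\left\{n<N,\ q\nmid n:\ \vert s_q(p(n))-s_q(n)\vert\leq \frac{q-1}{2}\right\}\gg N^{\gamma},$$ where the implied constant depends only on $q$ and $p(x)$.
   Context: For an integer $q\geq 2$ and a nonnegative integer $m$, $s_q(m)$ denotes the sum of the digits of $m$ in its base-$q$ expansion. $n$ ranges over positive integers. *)

theory Defs
  imports
    "HOL-Library.Landau_Symbols"
    "HOL-Library.Nat_Bijection"
    "HOL-Computational_Algebra.Polynomial"
begin

text \<open>For \<open>q < 2\<close> there is no base-\<open>q\<close> expansion; the value 0 there is junk.\<close>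

function digit_sum :: "nat \<Rightarrow> nat \<Rightarrow> nat" where
  "digit_sum q m = (if q < 2 \<or> m = 0 then 0 else m mod q + digit_sum q (m div q))"
  by auto
termination
  by (relation "measure snd") auto

declare digit_sum.simps [simp del]

text \<open>
  The total (general) recursive functions of Kleene. \<open>total_recursive k f\<close> only speaks about
  the values of \<open>f\<close> on lists of length \<open>k\<close>; values on other lists are junk and are never used.
  In primitive recursion the recursion variable is the head of the argument list, and
  minimization is only applied to functions for which the search always succeeds.
\<close>

inductive total_recursive :: "nat \<Rightarrow> (nat list \<Rightarrow> nat) \<Rightarrow> bool" where
  zero: "total_recursive k (\<lambda>xs. 0)"
| succ: "total_recursive 1 (\<lambda>xs. Suc (xs ! 0))"
| proj: "i < k \<Longrightarrow> total_recursive k (\<lambda>xs. xs ! i)"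
| comp: "\<lbrakk>total_recursive (length gs) f; \<And>g. g \<in> set gs \<Longrightarrow> total_recursive k g\<rbrakk>
    \<Longrightarrow> total_recursive k (\<lambda>xs. f (map (\<lambda>g. g xs) gs))"
| prec: "\<lbrakk>total_recursive k f; total_recursive (k + 2) g\<rbrakk>
    \<Longrightarrow> total_recursive (Suc k)
          (\<lambda>xs. rec_nat (f (tl xs)) (\<lambda>y r. g (y # r # tl xs)) (hd xs))"
| mini: "\<lbrakk>total_recursive (Suc k) f; \<And>xs. length xs = k \<Longrightarrow> \<exists>y. f (y # xs) = 0\<rbrakk>
    \<Longrightarrow> total_recursive k (\<lambda>xs. LEAST y. f (y # xs) = 0)"

definition int_poly_encode :: "int poly \<Rightarrow> nat" where
  "int_poly_encode p = list_encode (map int_encode (coeffs p))"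

text \<open>
  A real number depending on \<open>(q, p) \<in> D\<close> is computable (uniformly in \<open>q\<close> and \<open>p\<close>) if one
  algorithm produces, from \<open>q\<close>, the coefficients of \<open>p\<close> and a precision \<open>k\<close>, an integer \<open>a\<close>
  such that \<open>a / 2 ^ k\<close> approximates the number with error at most \<open>1 / 2 ^ k\<close>.
\<close>

definition computable_on :: "(nat \<times> int poly) set \<Rightarrow> (nat \<Rightarrow> int poly \<Rightarrow> real) \<Rightarrow> bool" where
  "computable_on D \<gamma> \<longleftrightarrow>
     (\<exists>f. total_recursive 3 f \<and>
        (\<forall>(q, p) \<in> D. \<forall>k.
           \<bar>\<gamma> q p - of_int (int_decode (f [q, int_poly_encode p, k])) / 2 ^ k\<bar> \<le> 1 / 2 ^ k))"

end

theory Submission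
  imports Defs
begin

text \<open>
  Fix \<open>e\<close> with \<open>e \<equiv> 1 (mod q)\<close> such that all coefficients of \<open>P(z) = p(e + z)\<close> are positive, and
  consider \<open>n = e + c (q ^ l - 1) x h(x)\<close> with \<open>x = q ^ k\<close>, where \<open>h\<close> is a fixed polynomial with
  exactly one negative coefficient, but all of whose higher powers have only positive ones. For large
  \<open>k\<close> the negative coefficient forces a borrow in \<open>n\<close>, so that \<open>s_q(n)\<close> equals \<open>(q - 1) k\<close> plus a
  term independent of \<open>k\<close>. In \<open>p(n)\<close> the negative coefficient is absorbed by the higher powers, so
  \<open>s_q(p(n))\<close> is the sum of the digit sums of the coefficients and does not depend on \<open>k\<close>. Hence
  \<open>s_q(p(n)) - s_q(n)\<close> decreases in steps of \<open>q - 1\<close> and meets the interval of radius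
  \<open>(q - 1) / 2\<close> around \<open>0\<close>, provided that it is nonnegative for the first admissible \<open>k\<close>. This holds
  because \<open>6 deg p\<close> coefficients are positive multiples of \<open>q ^ l - 1\<close>, and every such multiple
  has digit sum at least \<open>(q - 1) l\<close>. The resulting \<open>k\<close> is \<open>O(l)\<close>, so \<open>n\<close> is at most \<open>q ^ (E l)\<close> with
  \<open>E\<close> depending only on \<open>deg p\<close>, while about \<open>q ^ l\<close> values of \<open>c\<close> are available.
\<close>

subsection \<open>Digit sums\<close>

lemma digit_sum_0 [simp]: "digit_sum q 0 = 0"
  by (simp add: digit_sum.simps)

lemma digit_sum_rec: "q \<ge> 2 \<Longrightarrow> digit_sum q m = m mod q + digit_sum q (m div q)"
  by (cases "m = 0") (simp_all add: digit_sum.simps[of q m])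

lemma digit_sum_mult_add_digit:
  assumes "q \<ge> 2" "r < q"
  shows "digit_sum q (a * q + r) = digit_sum q a + r"
  using assms digit_sum_rec[of q "a * q + r"] by simp

lemma digit_sum_shift_add:
  assumes q: "q \<ge> 2"
  shows "b < q ^ k \<Longrightarrow> digit_sum q (a * q ^ k + b) = digit_sum q a + digit_sum q b"
proof (induction k arbitrary: b)
  case (Suc k)
  have lt: "b div q < q ^ k"
    using Suc.prems q by (simp add: less_mult_imp_div_less mult.commute)
  have "a * q ^ Suc k + b = (a * q ^ k + b div q) * q + b mod q"
    by (simp add: algebra_simps)
  also have "digit_sum q \<dots> = digit_sum q a + digit_sum q (b div q) + b mod q"
    using q by (subst digit_sum_mult_add_digit) (auto simp: Suc.IH[OF lt])
  also have "\<dots> = digit_sum q a + digit_sum q b"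
    using digit_sum_rec[OF q, of b] by simp
  finally show ?case .
qed simp

text \<open>The sum \<open>a + b\<close> is \<open>q ^ k - 1\<close>, all of whose \<open>k\<close>
  digits are \<open>q - 1\<close>. The addition has no carries, so the digits of \<open>a\<close>
  and \<open>b\<close> are complementary in each position.\<close>

lemma digit_sum_complement:
  assumes q: "q \<ge> 2"
  shows "a + b + 1 = q ^ k \<Longrightarrow> digit_sum q a + digit_sum q b = (q - 1) * k"
proof (induction k arbitrary: a b)
  case (Suc k)
  let ?r = "a mod q" and ?s = "b mod q"
  have "(a + b + 1) mod q = 0" using Suc.prems by simp
  hence "(?r + ?s + 1) mod q = 0" by (metis mod_add_eq mod_add_left_eq)
  hence rs: "?r + ?s + 1 = q"
  proof -
    assume "(?r + ?s + 1) mod q = 0"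
    then obtain t where t: "?r + ?s + 1 = q * t" by auto
    have "?r < q" "?s < q" using q by simp_all
    have "q * t < q * 2" using t \<open>?r < q\<close> \<open>?s < q\<close> by linarith
    hence "t < 2" by simp
    moreover have "t \<noteq> 0" using t by (intro notI) simp
    ultimately have "t = 1" by linarith
    with t show ?thesis by simp
  qed
  have "a + b + 1 = q * (a div q) + q * (b div q) + (?r + ?s + 1)"
    using mult_div_mod_eq[of q a] mult_div_mod_eq[of q b] by linarith
  hence "q * (a div q + b div q + 1) = q * q ^ k"
    using rs Suc.prems unfolding power_Suc add_mult_distrib2 by linarith
  hence "a div q + b div q + 1 = q ^ k" using q by (simp only: mult_cancel1) auto
  from Suc.IH[OF this] have
    "digit_sum q a + digit_sum q b = (q - 1) * k + (?r + ?s)"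
    using digit_sum_rec[OF q, of a] digit_sum_rec[OF q, of b] by linarith
  thus ?case using rs by auto
qed simp

lemma digit_sum_le:
  assumes "q \<ge> 2" "a < q ^ k"
  shows "digit_sum q a \<le> (q - 1) * k"
proof -
  have "a + (q ^ k - 1 - a) + 1 = q ^ k" using assms(2) by linarith
  from digit_sum_complement[OF assms(1) this] show ?thesis by linarith
qed

lemma digit_sum_Suc_le:
  assumes q: "q \<ge> 2"
  shows "digit_sum q (Suc a) \<le> Suc (digit_sum q a)"
proof (induction a rule: less_induct)
  case (less a)
  show ?case
  proof (cases "Suc (a mod q) = q")
    case True
    hence *: "Suc a mod q = 0" "Suc a div q = Suc (a div q)"
      by (simp_all add: mod_Suc div_Suc)
    have "a div q < a" using True q by (cases "a = 0") auto
    thus ?thesis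
      using less.IH[of "a div q"] digit_sum_rec[OF q, of a] digit_sum_rec[OF q, of "Suc a", unfolded *] True q
      by linarith
  next
    case False
    hence "Suc a mod q = Suc (a mod q)" "Suc a div q = a div q"
      using q by (simp_all add: mod_Suc div_Suc)
    thus ?thesis using digit_sum_rec[OF q, of a] digit_sum_rec[OF q, of "Suc a"] by simp
  qed
qed

text \<open>Each carry trades \<open>q\<close> units in one position for a single unit in the next.
  The induction keeps \<open>b\<close> arbitrary so that a carry can be pushed into the second
  summand, where \<open>digit_sum_Suc_le\<close> bounds its cost.\<close>

lemma digit_sum_add_le:
  assumes q: "q \<ge> 2"
  shows "digit_sum q (a + b) \<le> digit_sum q a + digit_sum q b"
proof (induction a arbitrary: b rule: less_induct)
  case (less a)
  show ?case
  proof (cases "a = 0")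
    case False
    hence IH: "digit_sum q (a div q + b') \<le> digit_sum q (a div q) + digit_sum q b'" for b'
      using less.IH[of "a div q"] q by simp
    let ?r = "a mod q" and ?s = "b mod q"
    have ab: "digit_sum q a = digit_sum q (a div q) + ?r" "digit_sum q b = digit_sum q (b div q) + ?s"
      using digit_sum_rec[OF q, of a] digit_sum_rec[OF q, of b] by simp_all
    have "?r < q" "?s < q" using q by simp_all
    show ?thesis
    proof (cases "?r + ?s < q")
      case True
      have "a + b = (a div q + b div q) * q + (?r + ?s)"
        using mult_div_mod_eq[of q a] mult_div_mod_eq[of q b] by (simp add: algebra_simps)
      hence "digit_sum q (a + b) = digit_sum q (a div q + b div q) + (?r + ?s)"
        using digit_sum_mult_add_digit[OF q True] by presburger
      thus ?thesis using IH[of "b div q"] ab by linarith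
    next
      case False
      have lt: "?r + ?s - q < q" using \<open>?r < q\<close> \<open>?s < q\<close> by linarith
      have "a + b = (a div q + Suc (b div q)) * q + (?r + ?s - q)"
        using div_mult_mod_eq[of a q] div_mult_mod_eq[of b q] False
        unfolding add_mult_distrib mult_Suc by linarith
      hence "digit_sum q (a + b) = digit_sum q (a div q + Suc (b div q)) + (?r + ?s - q)"
        using digit_sum_mult_add_digit[OF q lt] by presburger
      thus ?thesis using IH[of "Suc (b div q)"] ab digit_sum_Suc_le[OF q, of "b div q"] q False
        by linarith
    qed
  qed simp
qed

text \<open>Adding the two halves of \<open>m = a * q ^ l + b\<close> preserves divisibility by \<open>q ^ l - 1\<close>
  and does not increase the digit sum.\<close>

lemma digit_sum_multiple_ge:
  assumes q: "q \<ge> 2"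
  shows "m > 0 \<Longrightarrow> (q ^ l - 1) dvd m \<Longrightarrow> digit_sum q m \<ge> (q - 1) * l"
proof (induction m rule: less_induct)
  case (less m)
  have ql: "q ^ l > 0" using q by simp
  define a b where "a = m div q ^ l" and "b = m mod q ^ l"
  have m: "m = a * q ^ l + b" and b: "b < q ^ l"
    unfolding a_def b_def using ql by (simp_all only: div_mult_mod_eq mod_less_divisor)
  have ds: "digit_sum q m = digit_sum q a + digit_sum q b"
    unfolding m by (rule digit_sum_shift_add[OF q b])
  have "a * q ^ l = a * (q ^ l - 1) + a"
    using ql by (metis Suc_diff_1 mult_Suc_right add.commute)
  hence m': "m = a * (q ^ l - 1) + (a + b)" using m by simp
  show ?case
  proof (cases "a = 0")
    case True
    hence "m = q ^ l - 1" using less.prems m b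
      by (metis One_nat_def Suc_pred add_0 dvd_imp_le le_antisym less_Suc_eq_le mult_0 ql)
    thus ?thesis using digit_sum_complement[OF q, of m 0 l] ql by simp
  next
    case False
    show ?thesis
    \<comment> \<open>With \<open>q ^ l = 1\<close> the folded number \<open>a + b\<close> would not
      be smaller than \<open>m\<close>; but then \<open>l = 0\<close> and the bound is
      trivial.\<close>
    proof (cases "q ^ l = 1")
      case True
      thus ?thesis using q by simp
    next
      case ne: False
      have "(q ^ l - 1) dvd (a + b)" using less.prems(2) m' by (metis dvd_add_right_iff dvd_triv_right)
      moreover have "a + b < m"
      proof -
        have "1 < q ^ l" using ne ql by linarith
        hence "0 < a * (q ^ l - 1)" using False by (intro mult_pos_pos) linarith+
        thus ?thesis using m' by linarith
      qed
      ultimately show ?thesis using less.IH[of "a + b"] False digit_sum_add_le[OF q, of a b] ds by linarith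
    qed
  qed
qed

text \<open>The product has upper part \<open>a - 1\<close> and lower part \<open>q ^ l - a\<close>,
  and these two add up to \<open>q ^ l - 1\<close>.\<close>

lemma digit_sum_multiple_eq:
  assumes q: "q \<ge> 2" and a: "1 \<le> a" "a \<le> q ^ l"
  shows "digit_sum q (a * (q ^ l - 1)) = (q - 1) * l"
proof -
  have "a * (q ^ l - 1) = (a - 1) * q ^ l + (q ^ l - a)"
  proof -
    obtain a' where a': "a = Suc a'" using a by (cases a) auto
    obtain r where r: "q ^ l = a + r" using a le_Suc_ex by blast
    show ?thesis unfolding r a' by (simp add: algebra_simps)
  qed
  also have "digit_sum q \<dots> = digit_sum q (a - 1) + digit_sum q (q ^ l - a)"
    using a by (intro digit_sum_shift_add[OF q]) auto
  also have "\<dots> = (q - 1) * l"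
    using a by (intro digit_sum_complement[OF q]) auto
  finally show ?thesis .
qed

section \<open>Polynomial coefficients as digits in a large base\<close>

lemma poly_nonneg_of_coeffs:
  fixes H :: "int poly"
  assumes "\<And>i. coeff H i \<ge> 0" "x \<ge> 0"
  shows "poly H x \<ge> 0"
  using assms by (auto simp: poly_altdef intro!: sum_nonneg)

text \<open>Coefficients in this range are exactly the digits of the value in base
  \<open>q ^ k\<close>, so their base-\<open>q\<close> blocks are concatenated without
  interaction.\<close>

lemma digit_sum_poly:
  fixes H :: "int poly"
  assumes q: "q \<ge> 2"
  shows "(\<And>i. 0 \<le> coeff H i \<and> coeff H i < int (q ^ k)) \<Longrightarrow>
    digit_sum q (nat (poly H (int (q ^ k)))) = (\<Sum>i\<le>degree H. digit_sum q (nat (coeff H i)))"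
proof (induction H)
  case (pCons a H)
  have a: "0 \<le> a" "a < int (q ^ k)" using pCons.prems[of 0] by simp_all
  have H: "0 \<le> coeff H i \<and> coeff H i < int (q ^ k)" for i using pCons.prems[of "Suc i"] by simp
  have pos: "poly H (int (q ^ k)) \<ge> 0" by (rule poly_nonneg_of_coeffs) (use H in auto)
  have "nat (poly (pCons a H) (int (q ^ k))) = nat (poly H (int (q ^ k))) * q ^ k + nat a"
    using a pos by (simp add: nat_add_distrib nat_mult_distrib nat_power_eq mult.commute)
  hence "digit_sum q (nat (poly (pCons a H) (int (q ^ k)))) =
    digit_sum q (nat (poly H (int (q ^ k)))) + digit_sum q (nat a)"
    using digit_sum_shift_add[OF q] a by (metis nat_less_iff)
  also have "\<dots> = digit_sum q (nat a) + (\<Sum>i\<le>degree H. digit_sum q (nat (coeff H i)))"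
    using pCons.IH H by simp
  also have "\<dots> = (\<Sum>i\<le>degree (pCons a H). digit_sum q (nat (coeff (pCons a H) i)))"
  proof (cases "H = 0")
    case False
    thus ?thesis by (simp add: sum.atMost_Suc_shift del: sum.atMost_Suc)
  qed simp
  finally show ?case .
qed simp

lemma poly_less_power:
  fixes H :: "int poly"
  assumes "x > 0"
  shows "(\<And>i. 0 \<le> coeff H i \<and> coeff H i < x) \<Longrightarrow> poly H x < x ^ Suc (degree H)"
proof (induction H)
  case (pCons a H)
  have a: "a < x" using pCons.prems[of 0] by simp
  have H: "0 \<le> coeff H i \<and> coeff H i < x" for i using pCons.prems[of "Suc i"] by simp
  show ?case
  proof (cases "H = 0")
    case False
    have "x * (poly H x + 1) \<le> x * x ^ Suc (degree H)"
      using pCons.IH H assms by (intro mult_left_mono) auto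
    thus ?thesis using False a by (simp add: algebra_simps)
  qed (use a in simp)
qed (use assms in simp)

subsection \<open>Positivity of coefficients\<close>

lemma coeff_mult_pos:
  fixes f g :: "int poly"
  assumes f: "\<And>i. i \<le> degree f \<Longrightarrow> coeff f i > 0" and g: "\<And>i. i \<le> degree g \<Longrightarrow> coeff g i > 0"
    and i: "i \<le> degree f + degree g"
  shows "coeff (f * g) i > 0"
proof -
  have nn: "coeff f j \<ge> 0" "coeff g j \<ge> 0" for j
    using f[of j] g[of j] by (cases "j \<le> degree f"; cases "j \<le> degree g"; simp add: coeff_eq_0)+
  \<comment> \<open>One term of the convolution has both indices within the degrees; the other terms
    are nonnegative.\<close>
  have "0 < coeff f (min i (degree f)) * coeff g (i - min i (degree f))"
    using i by (intro mult_pos_pos f g) auto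
  also have "\<dots> \<le> (\<Sum>j\<le>i. coeff f j * coeff g (i - j))"
    using nn by (intro member_le_sum) auto
  finally show ?thesis by (simp add: coeff_mult)
qed

text \<open>Induction along Horner's scheme: \<open>a + x * p(x)\<close> becomes
  \<open>a + (e + z) * Q(z)\<close>, with coefficients \<open>e * Q_i + Q_(i-1)\<close>. Only the
  constant one also contains \<open>a\<close>, and taking \<open>e\<close> larger than
  \<open>\<bar>a\<bar>\<close> outweighs it.\<close>

lemma shifted_coeffs_pos:
  fixes p :: "int poly"
  assumes "lead_coeff p > 0"
  shows "\<exists>e0::nat. \<forall>e\<ge>e0. \<forall>i\<le>degree p. coeff (pcompose p [:int e, 1:]) i > 0"
  using assms
proof (induction p)
  case (pCons a p)
  show ?case
  proof (cases "p = 0")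
    case True
    thus ?thesis using pCons.prems by auto
  next
    case False
    then obtain e0 where e0: "coeff (pcompose p [:int e, 1:]) i > 0" if "e \<ge> e0" "i \<le> degree p" for e i
      using pCons by auto
    have "coeff (pcompose (pCons a p) [:int e, 1:]) i > 0"
      if e: "e \<ge> e0 + nat \<bar>a\<bar> + 1" and i: "i \<le> degree (pCons a p)" for e i
    proof -
      let ?Q = "pcompose p [:int e, 1:]"
      have Q: "coeff ?Q j > 0" if "j \<le> degree p" for j using e0 e that by simp
      have nn: "coeff ?Q j \<ge> 0" for j
        using Q[of j] by (cases "j \<le> degree p") (auto simp: coeff_eq_0 degree_pcompose)
      have "int e * 1 \<le> int e * coeff ?Q 0" using Q[of 0] by (intro mult_left_mono) auto
      moreover have "a + int e > 0" using e by linarith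
      moreover have "0 \<le> int e * coeff ?Q i" using nn by simp
      ultimately show ?thesis
        using Q[of "i - 1"] i False
        by (cases i) (auto simp: pcompose_pCons coeff_pCons)
    qed
    thus ?thesis by blast
  qed
qed simp

text \<open>The only negative coefficient disappears in all higher powers.\<close>

definition seed :: "int poly" where
  "seed = [:1, 2, -1, 3, 2, 1:]"

lemma degree_seed [simp]: "degree seed = 5"
  by (simp add: seed_def)

lemma degree_seed_power [simp]: "degree (seed ^ j) = 5 * j"
  by (subst degree_power_eq) (auto simp: seed_def)

lemma coeff_seed_2: "coeff seed 2 = -1"
  by (simp add: seed_def numeral_eq_Suc)

lemma coeff_seed_pos: "i \<le> 5 \<Longrightarrow> i \<noteq> 2 \<Longrightarrow> coeff seed i > 0"
  by (auto simp: seed_def coeff_pCons numeral_eq_Suc split: nat.splits)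

lemma seed_2: "seed ^ 2 = [:1, 4, 2, 2, 17, 4, 9, 10, 10, 4, 1:]"
  by (simp add: seed_def power2_eq_square)

lemma seed_3: "seed ^ 3 = [:1, 6, 9, 5, 33, 51, 14, 81, 69, 66, 51, 57, 41, 21, 6, 1:]"
  by (simp add: seed_def power3_eq_cube)

text \<open>The explicit square and cube are the base cases; every larger exponent is reached by
  multiplying with further squares, which preserves positivity.\<close>

lemma coeff_seed_power_pos:
  "j \<ge> 2 \<Longrightarrow> i \<le> 5 * j \<Longrightarrow> coeff (seed ^ j) i > 0"
proof (induction j arbitrary: i rule: less_induct)
  case (less j)
  have 2: "coeff (seed ^ 2) i > 0" if "i \<le> 10" for i
    using that unfolding seed_2 by (auto simp: coeff_pCons numeral_eq_Suc split: nat.splits)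
  have 3: "coeff (seed ^ 3) i > 0" if "i \<le> 15" for i
    using that unfolding seed_3 by (auto simp: coeff_pCons numeral_eq_Suc split: nat.splits)
  consider "j = 2" | "j = 3" | "j \<ge> 4" using less.prems by linarith
  thus ?case
  proof cases
    case 3
    then obtain j' where j': "j = 2 + j'" "j' \<ge> 2" by (metis le_add_diff_inverse add_le_cancel_left
          less.prems(1) numeral_Bit0)
    show ?thesis
      unfolding j'(1) power_add using less.IH[of j'] less.prems j' 2
      by (intro coeff_mult_pos) auto
  qed (use less.prems 2 3 in auto)
qed

section \<open>Coefficients of the composed polynomial\<close>

lemma coeff_pcompose_smult_shift:
  fixes P h :: "int poly"
  shows "coeff (pcompose P (smult y (pCons 0 h))) i =
    (\<Sum>j\<le>degree P. coeff P j * y ^ j * (if i < j then 0 else coeff (h ^ j) (i - j)))"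
proof -
  have "pCons 0 h = monom 1 1 * h" by (simp add: monom_altdef)
  hence *: "smult y (pCons 0 h) ^ j = smult (y ^ j) (monom 1 j * h ^ j)" for j
    by (simp add: smult_power power_mult_distrib monom_power)
  have "pcompose P (smult y (pCons 0 h)) =
    (\<Sum>j\<le>degree P. smult (coeff P j) (smult y (pCons 0 h) ^ j))"
    by (induction P) (simp_all add: pcompose_altdef poly_altdef degree_map_poly coeff_map_poly)
  thus ?thesis
    unfolding * by (auto simp: coeff_sum coeff_monom_mult mult_ac intro!: sum.cong)
qed

text \<open>Apart from the constant term, everything in \<open>P(y g)\<close> carries a factor
  \<open>y\<close>. This later supplies the multiples of \<open>q ^ l - 1\<close> whose digit sums
  are large.\<close>

lemma dvd_coeff_pcompose_smult:
  fixes P g :: "int poly"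
  assumes "i > 0"
  shows "y dvd coeff (pcompose P (smult y g)) i"
  using assms
proof (induction P)
  case (pCons a P)
  have "pcompose (pCons a P) (smult y g) = [:a:] + smult y (g * pcompose P (smult y g))"
    by (simp add: pcompose_pCons)
  thus ?case using pCons.prems by (cases i) auto
qed simp

lemma coeff_le_poly_1:
  fixes H :: "int poly"
  assumes "\<And>i. coeff H i \<ge> 0"
  shows "coeff H i \<le> poly H 1"
proof (cases "i \<le> degree H")
  case True
  thus ?thesis using assms member_le_sum[of i "{..degree H}" "coeff H"] by (simp add: poly_altdef)
next
  case False
  thus ?thesis using assms by (auto simp: poly_altdef coeff_eq_0 intro!: sum_nonneg)
qed

lemma poly_le_poly_1_power:
  fixes P :: "int poly"
  assumes "\<And>i. coeff P i \<ge> 0" "z \<ge> 1"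
  shows "poly P z \<le> poly P 1 * z ^ degree P"
  unfolding poly_altdef sum_distrib_right
  using assms by (auto intro!: sum_mono mult_left_mono power_increasing)

text \<open>The only negative contribution comes from \<open>j = 1\<close> at \<open>i = 3\<close>,
  namely \<open>- coeff P 1 * y\<close>. The quadratic term contributes
  \<open>4 * coeff P 2 * y ^ 2\<close> there, which wins once \<open>y > coeff P 1\<close>.\<close>

lemma coeff_composition_pos:
  fixes P :: "int poly"
  assumes P: "\<And>i. i \<le> degree P \<Longrightarrow> coeff P i > 0" and d: "degree P \<ge> 2"
    and y: "y > coeff P 1" and i: "i \<le> 6 * degree P"
  shows "coeff (pcompose P (smult y (pCons 0 seed))) i > 0"
proof -
  define t where "t j = coeff P j * y ^ j * (if i < j then 0 else coeff (seed ^ j) (i - j))" for j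
  have y0: "y > 0" using P[of 1] y d by linarith
  have sp: "coeff (seed ^ j) k \<ge> 0" if "j \<noteq> 1" for j k
  proof (cases "j \<ge> 2")
    case True
    thus ?thesis using coeff_seed_power_pos[of j k] by (cases "k \<le> 5 * j") (auto simp: coeff_eq_0)
  next
    case False
    hence "j = 0" using that by linarith
    thus ?thesis by simp
  qed
  have tnn: "t j \<ge> 0" if "j \<le> degree P" "j \<noteq> 1" for j
    unfolding t_def using P[OF that(1)] y0 sp[OF that(2)] by (intro mult_nonneg_nonneg) auto
  have "(\<Sum>j\<le>degree P. t j) > 0"
  proof (cases "i = 3")
    case True
    have t1: "t 1 = - (coeff P 1 * y)" using True by (simp add: t_def coeff_seed_2)
    have t2: "t 2 = coeff P 2 * y ^ 2 * 4" unfolding t_def seed_2 using True by (simp add: numeral_eq_Suc)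
    have "coeff P 1 * y < y * y" using y y0 by simp
    also have "y * y = 1 * y ^ 2 * 1" by (simp add: power2_eq_square)
    also have "\<dots> \<le> t 2" unfolding t2 using P[of 2] d by (intro mult_mono) auto
    finally have "0 < t 1 + t 2" using t1 by linarith
    also have "\<dots> = (\<Sum>j\<in>{1,2}. t j)" by simp
    also have "\<dots> \<le> (\<Sum>j\<le>degree P. t j)"
      using d tnn by (intro sum_mono2) auto
    finally show ?thesis .
  next
    case False
    have tnn': "t j \<ge> 0" if "j \<le> degree P" for j
    proof (cases "j = 1")
      case True
      have "coeff seed (i - 1) \<ge> 0" if "i \<ge> 1"
      proof -
        have "i - 1 \<noteq> 2" using False that by linarith
        thus ?thesis
          using coeff_seed_pos[of "i - 1"] by (cases "i - 1 \<le> 5") (auto simp: coeff_eq_0)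
      qed
      thus ?thesis unfolding t_def using P[OF that] y0 True by (intro mult_nonneg_nonneg) auto
    qed (use tnn that in auto)
    \<comment> \<open>This is \<open>i / 6\<close> rounded up: the powers in
      \<open>(x * seed) ^ j\<close> run from \<open>j\<close> to \<open>6 * j\<close>, so
      \<open>i\<close> is among them.\<close>
    define j where "j = (i + 5) div 6"
    have j: "j \<le> i" "i \<le> 6 * j" "j \<le> degree P" using i unfolding j_def by linarith+
    have "coeff (seed ^ j) (i - j) > 0"
    proof -
      consider "j = 0" | "j = 1" | "j \<ge> 2" by linarith
      thus ?thesis
      proof cases
        case 1
        thus ?thesis using j by simp
      next
        case 2
        thus ?thesis using coeff_seed_pos[of "i - 1"] False j by simp
      next
        case 3
        thus ?thesis using coeff_seed_power_pos[of j "i - j"] j by simp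
      qed
    qed
    hence "0 < t j" unfolding t_def using P[OF j(3)] y0 j by (intro mult_pos_pos) auto
    also have "\<dots> \<le> (\<Sum>j\<le>degree P. t j)" using tnn' j by (intro member_le_sum) auto
    finally show ?thesis .
  qed
  thus ?thesis unfolding coeff_pcompose_smult_shift t_def .
qed

subsection \<open>Balanced arguments\<close>

text \<open>The candidate \<open>n\<close>; \<open>y\<close> will be a multiple of
  \<open>q ^ l - 1\<close>. For \<open>q \<ge> 2\<close> the integer is nonnegative, so
  \<open>nat\<close> loses nothing.\<close>

definition argument :: "nat \<Rightarrow> nat \<Rightarrow> nat \<Rightarrow> nat \<Rightarrow> nat" where
  "argument q e y k = nat (int e + int y * int (q ^ k) * poly seed (int (q ^ k)))"

lemma poly_seed_pos:
  assumes "x \<ge> 1"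
  shows "poly seed (x::int) > 0"
proof -
  have "x ^ 2 \<le> x ^ 3" using assms by (intro power_increasing) auto
  moreover have "poly seed x = 1 + 2 * x - x ^ 2 + 3 * x ^ 3 + 2 * x ^ 4 + x ^ 5"
    by (simp add: seed_def algebra_simps eval_nat_numeral)
  moreover have "x ^ 3 \<ge> 0" "x ^ 4 \<ge> 0" "x ^ 5 \<ge> 0" using assms by auto
  ultimately show ?thesis using assms by linarith
qed

lemma int_argument:
  assumes "q \<ge> 2"
  shows "int (argument q e y k) = int e + int y * int (q ^ k) * poly seed (int (q ^ k))"
proof -
  have "1 \<le> int (q ^ k)" using assms by simp
  thus ?thesis using poly_seed_pos[of "int (q ^ k)"] by (simp add: argument_def)
qed

text \<open>The block \<open>q ^ k - y\<close> created by the borrow is complementary to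
  \<open>y - 1\<close>; this is the source of \<open>(q - 1) * k\<close>. The digit sum of
  \<open>y - 1\<close> stands on the left to avoid truncated subtraction.\<close>

lemma
  assumes q: "q \<ge> 2" and y: "y > 0" "3 * y \<le> q ^ k" and e: "e < q ^ k"
  shows argument_less: "argument q e y k < q ^ (7 * k)"
    and digit_sum_argument: "digit_sum q (argument q e y k) + digit_sum q (y - 1) =
      digit_sum q e + 2 * digit_sum q y + 2 * digit_sum q (2 * y) + digit_sum q (3 * y - 1) + (q - 1) * k"
proof -
  define x where "x = q ^ k"
  \<comment> \<open>The base-\<open>x\<close> digits after the borrow: \<open>-y\<close> at
    \<open>x ^ 3\<close> becomes \<open>x - y\<close>, and \<open>3 * y\<close> at
    \<open>x ^ 4\<close> drops to \<open>3 * y - 1\<close>.\<close>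
  define G where "G = [:int e, int y, int (2 * y), int (x - y), int (3 * y - 1), int (2 * y), int y:]"
  have yx: "y \<le> x" using y x_def by linarith
  have "poly G (int x) = int e + int y * int x * poly seed (int x)"
    unfolding G_def seed_def using yx y by (simp add: algebra_simps of_nat_diff)
  hence G: "argument q e y k = nat (poly G (int (q ^ k)))"
    by (simp add: argument_def x_def)
  have b: "0 \<le> coeff G i \<and> coeff G i < int (q ^ k)" for i
  proof -
    have "0 < x" using q x_def by simp
    thus ?thesis unfolding G_def x_def[symmetric] using y e unfolding x_def[symmetric]
      by (auto simp: coeff_pCons split: nat.splits)
  qed
  have deg: "degree G = 6" using y by (simp add: G_def)
  have "poly G (int (q ^ k)) < int (q ^ k) ^ 7"
    using poly_less_power[of "int (q ^ k)" G] b q deg by (simp add: eval_nat_numeral)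
  also have "\<dots> = int (q ^ (7 * k))" by (simp add: power_mult[symmetric] mult.commute)
  finally show "argument q e y k < q ^ (7 * k)" unfolding G
    using poly_nonneg_of_coeffs[of G "int (q ^ k)"] b by (simp add: nat_less_iff)
  have "digit_sum q (argument q e y k) = (\<Sum>i\<le>degree G. digit_sum q (nat (coeff G i)))"
    unfolding G by (rule digit_sum_poly[OF q]) (use b in auto)
  also have "{..degree G} = {0, 1, 2, 3, 4, 5, 6}" unfolding deg by auto
  also have "(\<Sum>i\<in>\<dots>. digit_sum q (nat (coeff G i))) =
    digit_sum q e + 2 * digit_sum q y + 2 * digit_sum q (2 * y) + digit_sum q (3 * y - 1) + digit_sum q (x - y)"
  proof -
    have "coeff G 0 = int e" "coeff G 1 = int y" "coeff G 2 = int (2 * y)" "coeff G 3 = int (x - y)"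
      "coeff G 4 = int (3 * y - 1)" "coeff G 5 = int (2 * y)" "coeff G 6 = int y"
      by (simp_all add: G_def numeral_eq_Suc del: of_nat_mult of_nat_diff)
    thus ?thesis by (simp del: of_nat_mult of_nat_diff)
  qed
  finally have "digit_sum q (argument q e y k) = \<dots>" .
  moreover have "digit_sum q (x - y) + digit_sum q (y - 1) = (q - 1) * k"
    using yx y by (intro digit_sum_complement[OF q]) (auto simp: x_def)
  ultimately show "digit_sum q (argument q e y k) + digit_sum q (y - 1) =
      digit_sum q e + 2 * digit_sum q y + 2 * digit_sum q (2 * y) + digit_sum q (3 * y - 1) + (q - 1) * k"
    by linarith
qed

text \<open>Both \<open>c\<close> and the value of \<open>seed\<close> at \<open>q ^ k\<close> are
  \<open>1\<close> modulo \<open>q\<close>, so their product is not divisible by \<open>q\<close>.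
  Comparing powers of \<open>q\<close> forces \<open>k = k'\<close>, and then the common positive
  factors cancel.\<close>

lemma argument_inj:
  assumes q: "q \<ge> 2" and M: "M > 0" and k: "k \<ge> 1" "k' \<ge> 1"
    and c: "c mod q = 1" "c' mod q = 1"
    and eq: "argument q e (c * M) k = argument q e (c' * M) k'"
  shows "c = c'"
proof -
  have ndvd: "\<not> int q dvd int c * poly seed (int (q ^ k))" if "c mod q = 1" "k \<ge> 1" for c k
  proof
    have "int c mod int q = 1" using that by (metis of_nat_1 zmod_int)
    moreover have "poly seed (int (q ^ k)) mod int q = 1"
    proof -
      have "poly seed (int (q ^ k)) = 1 + int q * (int (q ^ (k - 1)) * poly [:2, -1, 3, 2, 1:] (int (q ^ k)))"
        using that by (cases k) (auto simp: seed_def)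
      thus ?thesis using q by simp
    qed
    ultimately have "int c * poly seed (int (q ^ k)) mod int q = 1"
      using q by (metis mod_mult_eq mult_1 mod_less of_nat_1 zmod_int one_less_numeral_iff
          less_le_trans semiring_norm(76))
    moreover assume "int q dvd int c * poly seed (int (q ^ k))"
    ultimately show False by simp
  qed
  have le: "k' \<le> k" if "c' mod q = 1" "k' \<ge> 1" "k \<ge> 1"
    and eq: "int c * int (q ^ k) * poly seed (int (q ^ k)) = int c' * int (q ^ k') * poly seed (int (q ^ k'))"
      and "c mod q = 1" for c c' k k'
  proof (rule ccontr)
    assume "\<not> k' \<le> k"
    then obtain j where j: "k' = k + Suc j" using less_imp_Suc_add not_le_imp_less by fastforce
    have "int (q ^ k) * (int c * poly seed (int (q ^ k))) =
      int (q ^ k) * (int q * (int (q ^ j) * int c' * poly seed (int (q ^ k'))))"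
      using eq unfolding j by (simp add: power_add mult_ac)
    hence "int c * poly seed (int (q ^ k)) = int q * (int (q ^ j) * int c' * poly seed (int (q ^ k')))"
      using q by (subst (asm) mult_cancel_left) auto
    thus False using ndvd[of c k] that by auto
  qed
  have "int M * (int c * int (q ^ k) * poly seed (int (q ^ k))) =
    int M * (int c' * int (q ^ k') * poly seed (int (q ^ k')))"
    using arg_cong[OF eq, of int] unfolding int_argument[OF q] by (simp add: mult_ac)
  hence eq': "int c * int (q ^ k) * poly seed (int (q ^ k)) = int c' * int (q ^ k') * poly seed (int (q ^ k'))"
    using M by (subst (asm) mult_cancel_left) auto
  have "k = k'" using le[OF c(2) k(2,1) eq' c(1)] le[OF c(1) k(1,2) eq'[symmetric] c(2)] by simp
  moreover have "poly seed (int (q ^ k)) > 0" using q by (intro poly_seed_pos) auto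
  ultimately show ?thesis using eq' q by simp
qed

text \<open>Beyond a threshold \<open>k0\<close> the digit sum of the value is a constant
  \<open>S\<close>, while that of the argument is \<open>T + (q - 1) * k\<close>. The difference
  \<open>w\<close> at \<open>k0\<close> is nonnegative, so rounding \<open>w / (q - 1)\<close> tells
  how far to move on from \<open>k0\<close>.\<close>

lemma exists_balanced_argument:
  fixes P :: "int poly"
  assumes q: "q \<ge> 2" and P: "\<And>i. i \<le> degree P \<Longrightarrow> coeff P i > 0" and d: "degree P \<ge> 2"
    and c: "c \<ge> 1" "3 * c \<le> q ^ l" and l: "l \<ge> 1" "digit_sum q e \<le> l" "e < q ^ l"
      "coeff P 1 < int (q ^ l - 1)" "poly P 1 * 8 ^ degree P < int (q ^ l)"
  defines "y \<equiv> c * (q ^ l - 1)"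
  shows "\<exists>k\<ge>1. k \<le> ((6 * degree P + 1) * (2 * degree P + 1) + 3) * l \<and>
    argument q e y k < q ^ (7 * k) \<and>
    2 * \<bar>int (digit_sum q (nat (poly P (int (argument q e y k) - int e)))) -
      int (digit_sum q (argument q e y k))\<bar> \<le> int q - 1"
proof -
  define d where "d = degree P"
  \<comment> \<open>Chosen so that \<open>q ^ k0\<close> exceeds every coefficient of
    \<open>H\<close>: these are at most \<open>P(8 * y)\<close>, where \<open>8\<close> is the value
    of \<open>seed\<close> at \<open>1\<close>, and this is below
    \<open>q ^ l * (q ^ (2 * l)) ^ d\<close>.\<close>
  define k0 where "k0 = (2 * d + 1) * l"
  define r where "r = int q - 1"
  define H where "H = pcompose P (smult (int y) (pCons 0 seed))"
  have r: "r \<ge> 1" and rq: "int (q - 1) = r" using q by (simp_all add: r_def)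
  have M: "q ^ l - 1 > 0" using l(4) P[of 1] d by linarith
  have y1: "y \<ge> 1" using c M by (simp add: y_def)
  hence y0: "y > 0" by simp
  have yM: "y \<ge> q ^ l - 1" using c by (simp add: y_def)
  have y3: "3 * y \<le> q ^ (2 * l)"
  proof -
    have "3 * c * (q ^ l - 1) \<le> q ^ l * q ^ l" using c by (intro mult_le_mono) auto
    thus ?thesis by (simp add: y_def mult_2 power_add mult.assoc)
  qed
  have Ppos: "coeff P i \<ge> 0" for i using P[of i] by (cases "i \<le> degree P") (auto simp: coeff_eq_0)
  have degH: "degree H = 6 * d"
  proof -
    have "seed \<noteq> 0" by (simp add: seed_def)
    thus ?thesis using y1 by (simp add: H_def degree_pcompose d_def)
  qed
  have yP: "int y > coeff P 1" using yM l(4) by linarith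
  have Hpos: "coeff H i > 0" if "i \<le> 6 * d" for i
    unfolding H_def using that d_def d yP by (intro coeff_composition_pos P) auto
  have Hnn: "coeff H i \<ge> 0" for i
    using Hpos[of i] by (cases "i \<le> 6 * d") (auto simp: coeff_eq_0 degH)
  have Hlt: "coeff H i < int (q ^ k0)" for i
  proof -
    have "coeff H i \<le> poly H 1" by (rule coeff_le_poly_1) (rule Hnn)
    also have "\<dots> = poly P (8 * int y)" by (simp add: H_def poly_pcompose seed_def mult.commute)
    also have "\<dots> \<le> poly P 1 * (8 * int y) ^ d"
      unfolding d_def using y1 by (intro poly_le_poly_1_power Ppos) auto
    also have "\<dots> = (poly P 1 * 8 ^ d) * int y ^ d" by (simp add: power_mult_distrib)
    also have "\<dots> < int (q ^ l) * int y ^ d"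
      using l(5) y1 by (intro mult_strict_right_mono) (auto simp: d_def)
    also have "\<dots> \<le> int (q ^ l) * int (q ^ (2 * l)) ^ d"
      using y3 by (intro mult_left_mono power_mono) (auto simp flip: of_nat_power)
    also have "\<dots> = int (q ^ k0)"
      by (simp add: k0_def power_mult[symmetric] power_add algebra_simps)
    finally show ?thesis .
  qed
  define S where "S = (\<Sum>i\<le>6*d. digit_sum q (nat (coeff H i)))"
  have S: "digit_sum q (nat (poly P (int (argument q e y k) - int e))) = S" if "k \<ge> k0" for k
  proof -
    have "poly P (int (argument q e y k) - int e) = poly H (int (q ^ k))"
      by (simp add: int_argument[OF q] H_def poly_pcompose mult_ac)
    moreover have "int (q ^ k0) \<le> int (q ^ k)" using that q by (simp add: power_increasing)
    ultimately show ?thesis using digit_sum_poly[OF q, of H k] Hnn Hlt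
      unfolding S_def degH by (metis order_less_le_trans)
  qed
  have S_ge: "S \<ge> 6 * d * ((q - 1) * l)"
  proof -
    \<comment> \<open>The sum starts at \<open>1\<close> because the constant coefficient need not
      be a multiple of \<open>y\<close>.\<close>
    have "(\<Sum>i\<in>{1..6*d}. (q - 1) * l) \<le> (\<Sum>i\<in>{1..6*d}. digit_sum q (nat (coeff H i)))"
    proof (intro sum_mono digit_sum_multiple_ge[OF q])
      fix i assume i: "i \<in> {1..6*d}"
      show "nat (coeff H i) > 0" using Hpos[of i] i by simp
      have "int y dvd coeff H i" unfolding H_def using i by (intro dvd_coeff_pcompose_smult) auto
      hence "int y dvd int (nat (coeff H i))" using Hnn[of i] by simp
      hence "y dvd nat (coeff H i)" by (simp only: int_dvd_int_iff)
      thus "q ^ l - 1 dvd nat (coeff H i)" unfolding y_def by (rule dvd_mult_right)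
    qed
    also have "\<dots> \<le> S" unfolding S_def by (intro sum_mono2) auto
    finally show ?thesis by simp
  qed
  have S_le: "S \<le> (6 * d + 1) * ((q - 1) * k0)"
  proof -
    have "digit_sum q (nat (coeff H i)) \<le> (q - 1) * k0" for i
      using Hlt[of i] Hnn[of i] by (intro digit_sum_le[OF q]) (simp add: nat_less_iff)
    hence "S \<le> (\<Sum>i\<le>6*d. (q - 1) * k0)" unfolding S_def by (intro sum_mono) auto
    thus ?thesis by simp
  qed
  define T where "T = int (digit_sum q e) + 2 * int (digit_sum q y) + 2 * int (digit_sum q (2 * y))
    + int (digit_sum q (3 * y - 1)) - int (digit_sum q (y - 1))"
  have k0: "2 * l \<le> k0" using d unfolding k0_def d_def by (intro mult_le_mono) auto
  have pw: "e < q ^ k" "3 * y \<le> q ^ k" if "k \<ge> k0" for k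
  proof -
    have "q ^ l \<le> q ^ k" "q ^ (2 * l) \<le> q ^ k"
      using that k0 q by (auto intro!: power_increasing)
    thus "e < q ^ k" "3 * y \<le> q ^ k" using y3 l(3) by linarith+
  qed
  have T: "int (digit_sum q (argument q e y k)) = T + r * int k" if "k \<ge> k0" for k
    using arg_cong[OF digit_sum_argument[OF q y0 pw(2)[OF that] pw(1)[OF that]], of int]
    unfolding T_def of_nat_add of_nat_mult of_nat_numeral rq by linarith
  define Q where "Q = r * int l"
  have Qq: "int ((q - 1) * l) = Q" by (simp only: Q_def of_nat_mult rq)
  have lQ: "int l \<le> Q" using r by (simp add: Q_def mult_le_cancel_right1)
  \<comment> \<open>The count is \<open>1\<close> for \<open>e\<close>, \<open>2 + 2\<close> for
    \<open>y\<close> and \<open>2 * y\<close>, and \<open>2\<close> for \<open>3 * y - 1\<close>,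
    which has up to \<open>2 * l\<close> digits.\<close>
  have T_le: "T \<le> 7 * Q"
  proof -
    have "digit_sum q y = (q - 1) * l" "digit_sum q (2 * y) = (q - 1) * l"
      using digit_sum_multiple_eq[OF q, of c l] digit_sum_multiple_eq[OF q, of "2 * c" l] c
      by (simp_all add: y_def mult.assoc)
    moreover have "digit_sum q (3 * y - 1) \<le> (q - 1) * (2 * l)"
      using y3 y1 by (intro digit_sum_le[OF q]) linarith
    hence "int (digit_sum q (3 * y - 1)) \<le> 2 * Q" using Qq
      by (metis mult.left_commute of_nat_le_iff of_nat_mult of_nat_numeral)
    ultimately show ?thesis unfolding T_def using lQ l(2) Qq by simp
  qed
  have T_ge: "T \<ge> - 2 * Q"
  proof -
    have "digit_sum q (y - 1) \<le> (q - 1) * (2 * l)"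
      using y3 y1 by (intro digit_sum_le[OF q]) linarith
    hence "int (digit_sum q (y - 1)) \<le> 2 * Q" using Qq
      by (metis mult.left_commute of_nat_le_iff of_nat_mult of_nat_numeral)
    thus ?thesis unfolding T_def by linarith
  qed
  define w where "w = int S - T - r * int k0"
  have rk0: "r * int k0 = (2 * int d + 1) * Q" by (simp add: k0_def Q_def algebra_simps)
  \<comment> \<open>In units of \<open>Q\<close> this needs
    \<open>6 * d \<ge> 7 + (2 * d + 1)\<close>, which is exactly \<open>d \<ge> 2\<close>.\<close>
  have w: "w \<ge> 0"
  proof -
    have "int (6 * d * ((q - 1) * l)) = 6 * int d * Q" using Qq by (metis of_nat_mult of_nat_numeral)
    hence "int S \<ge> 6 * int d * Q" using S_ge by (metis of_nat_le_iff)
    moreover have "8 * Q \<le> (4 * int d) * Q" using d lQ by (intro mult_right_mono) (auto simp: d_def)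
    ultimately show ?thesis using T_le unfolding w_def rk0 by (simp add: algebra_simps)
  qed
  \<comment> \<open>The integer nearest to \<open>w / r\<close>, so the remaining error is at most
    \<open>r / 2\<close>.\<close>
  define j where "j = (2 * w + r) div (2 * r)"
  have j: "\<bar>2 * (w - r * j)\<bar> \<le> r"
  proof -
    have "2 * w + r = 2 * r * j + (2 * w + r) mod (2 * r)" by (simp add: j_def)
    moreover have "0 \<le> (2 * w + r) mod (2 * r)" "(2 * w + r) mod (2 * r) < 2 * r" using r by simp_all
    ultimately show ?thesis by (simp add: abs_le_iff)
  qed
  have j0: "j \<ge> 0" using w r by (simp add: j_def pos_imp_zdiv_nonneg_iff)
  define k where "k = k0 + nat j"
  have kk: "int k = int k0 + j" and kk0: "k \<ge> k0" using j0 by (simp_all add: k_def)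
  have D: "int S - (T + r * int k) = w - r * j"
    unfolding kk w_def by (simp add: algebra_simps)
  have main: "2 * \<bar>int (digit_sum q (nat (poly P (int (argument q e y k) - int e)))) -
      int (digit_sum q (argument q e y k))\<bar> \<le> int q - 1"
    unfolding S[OF kk0] T[OF kk0] D using j unfolding r_def by linarith
  have "k \<le> ((6 * d + 1) * (2 * d + 1) + 3) * l"
  proof -
    have "int ((6 * d + 1) * ((q - 1) * k0)) = (6 * int d + 1) * (r * int k0)"
      by (simp only: of_nat_mult of_nat_add of_nat_numeral rq of_nat_1)
    hence "int S \<le> (6 * int d + 1) * (r * int k0)" using S_le by (metis of_nat_le_iff)
    moreover have "2 * (r * int k) \<le> 2 * (int S - T) + r"
      using abs_le_D2[OF j, folded D] by (simp add: right_diff_distrib)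
    moreover have "r \<le> Q" using r l(1) by (simp add: Q_def)
    \<comment> \<open>The \<open>3 * Q\<close> covers \<open>2 * Q\<close> from the lower bound on
      \<open>T\<close> and the rounding error, as \<open>r \<le> Q\<close>.\<close>
    ultimately have "2 * (r * int k) \<le> 2 * ((6 * int d + 1) * ((2 * int d + 1) * Q) + 3 * Q)"
      using T_ge r unfolding rk0
      by (simp add: algebra_simps)
    also have "\<dots> = 2 * (r * int (((6 * d + 1) * (2 * d + 1) + 3) * l))"
      by (simp add: Q_def algebra_simps)
    finally have "r * int k \<le> r * int (((6 * d + 1) * (2 * d + 1) + 3) * l)" by linarith
    hence "int k \<le> int (((6 * d + 1) * (2 * d + 1) + 3) * l)"
      using r by (subst (asm) mult_le_cancel_left_pos) auto
    thus ?thesis by (simp only: of_nat_le_iff)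
  qed
  moreover have "k \<ge> 1" using k0 kk0 l(1) by linarith
  moreover have "argument q e y k < q ^ (7 * k)"
    using y1 pw[OF kk0] by (intro argument_less[OF q]) auto
  ultimately show ?thesis using main unfolding d_def by blast
qed

subsection \<open>The exponent\<close>

text \<open>The constructed \<open>n\<close> have 7 digits in base \<open>q ^ k\<close>, where \<open>k\<close> is at most \<open>l\<close> times the factor
  in parentheses.\<close>

definition exponent_bound :: "nat \<Rightarrow> nat" where
  "exponent_bound d = 7 * ((6 * d + 1) * (2 * d + 1) + 3)"

text \<open>The pairing function grows quadratically: a one-element list already has code at least
  \<open>6\<close>, and from there each further entry adds at least \<open>12\<close>.\<close>

lemma list_encode_ge:
  assumes "xs \<noteq> []" "last xs \<ge> 2"
  shows "list_encode xs \<ge> 12 * length xs - 6"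
  using assms
proof (induction xs)
  case (Cons x xs)
  have mono: "triangle m \<le> triangle n" if "m \<le> n" for m n
    using that unfolding triangle_def by (intro div_le_mono mult_le_mono) auto
  show ?case
  proof (cases "xs = []")
    case True
    have "triangle 2 \<le> triangle x" using Cons.prems True by (intro mono) simp
    thus ?thesis using Cons.prems True by (simp add: prod_encode_def eval_nat_numeral)
  next
    case False
    define c where "c = list_encode xs"
    have c: "c \<ge> 12 * length xs - 6" using Cons False by (simp add: c_def)
    have "length xs \<ge> 1" using False by (cases xs) auto
    have "triangle c \<le> triangle (x + c)" by (rule mono) simp
    moreover have "triangle c \<ge> c + 12"
    proof -
      have "c \<ge> 6" using c \<open>length xs \<ge> 1\<close> by linarith
      hence "c * 7 \<le> c * Suc c" by (intro mult_le_mono) auto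
      hence "c * 7 div 2 \<le> triangle c" unfolding triangle_def by (rule div_le_mono)
      thus ?thesis using \<open>c \<ge> 6\<close> by linarith
    qed
    ultimately show ?thesis using c \<open>length xs \<ge> 1\<close>
      by (simp add: prod_encode_def c_def[symmetric])
  qed
qed simp

lemma int_poly_encode_ge:
  assumes "lead_coeff p > 0"
  shows "int_poly_encode p \<ge> 12 * degree p + 6"
proof -
  have p: "p \<noteq> 0" using assms by auto
  have "int_encode (lead_coeff p) = 2 * nat (lead_coeff p)"
    using assms by (simp add: int_encode_def sum_encode_def)
  moreover have "last (map int_encode (coeffs p)) = int_encode (lead_coeff p)"
    using p by (simp add: last_map last_coeffs_eq_coeff_degree)
  ultimately have "list_encode (map int_encode (coeffs p)) \<ge> 12 * length (map int_encode (coeffs p)) - 6"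
    using p assms by (intro list_encode_ge) auto
  thus ?thesis using p by (simp add: int_poly_encode_def length_coeffs)
qed

text \<open>This allows \<open>1 / 2 ^ int_poly_encode p\<close> as the exponent, which is computed
  from the code of \<open>p\<close> without extracting the degree.\<close>

lemma exponent_bound_le:
  assumes "lead_coeff p > 0" "degree p \<ge> 2"
  shows "exponent_bound (degree p) \<le> 2 ^ int_poly_encode p"
proof -
  define d where "d = degree p"
  have "2 * d \<le> d * d" "4 \<le> d * d" using assms(2) mult_le_mono[of 2 d 2 d] by (auto simp: d_def)
  moreover have "exponent_bound d = 84 * (d * d) + 56 * d + 28"
    by (simp add: exponent_bound_def algebra_simps)
  ultimately have "exponent_bound d \<le> 1024 * (d * d)" by linarith
  also have "\<dots> \<le> 2 ^ 10 * (2 ^ d * 2 ^ d)"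
    using less_exp[of d] by (intro mult_le_mono) auto
  also have "\<dots> = 2 ^ (10 + d + d)" by (simp only: power_add mult.assoc)
  also have "\<dots> \<le> 2 ^ int_poly_encode p"
    using int_poly_encode_ge[OF assms(1)] assms(2) by (intro power_increasing) (auto simp: d_def)
  finally show ?thesis unfolding d_def .
qed

subsection \<open>Computability\<close>

lemma total_recursive_Suc:
  assumes "total_recursive k g"
  shows "total_recursive k (\<lambda>xs. Suc (g xs))"
proof -
  have "total_recursive k (\<lambda>xs. (\<lambda>xs. Suc (xs ! 0)) (map (\<lambda>g. g xs) [g]))"
    using assms by (intro total_recursive.comp) (auto intro: total_recursive.succ[simplified])
  thus ?thesis by simp
qed

lemma total_recursive_comp2:
  assumes "total_recursive 2 f" "total_recursive k g" "total_recursive k h"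
  shows "total_recursive k (\<lambda>xs. f [g xs, h xs])"
proof -
  have "total_recursive k (\<lambda>xs. f (map (\<lambda>g. g xs) [g, h]))"
    using assms by (intro total_recursive.comp) (auto simp: numeral_2_eq_2)
  thus ?thesis by simp
qed

lemma total_recursive_comp1:
  assumes "total_recursive 1 f" "total_recursive k g"
  shows "total_recursive k (\<lambda>xs. f [g xs])"
proof -
  have "total_recursive k (\<lambda>xs. f (map (\<lambda>g. g xs) [g]))"
    using assms by (intro total_recursive.comp) auto
  thus ?thesis by simp
qed


lemma total_recursive_double: "\<exists>f. total_recursive 1 f \<and> (\<forall>n. f [n] = 2 * n)"
proof -
  have "total_recursive (Suc 0) (\<lambda>xs. rec_nat ((\<lambda>_. 0) (tl xs))
      (\<lambda>y r. (\<lambda>xs. Suc (Suc (xs ! 1))) (y # r # tl xs)) (hd xs))"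
    by (intro total_recursive.prec total_recursive.zero total_recursive_Suc total_recursive.proj) simp
  moreover have "rec_nat 0 (\<lambda>y r. Suc (Suc r)) n = 2 * n" for n
    by (induction n) auto
  ultimately show ?thesis by (intro exI[of _ "\<lambda>xs. rec_nat 0 (\<lambda>y r. Suc (Suc r)) (hd xs)"]) simp
qed

text \<open>The extra factor \<open>2\<close> anticipates \<open>int_encode\<close>, so that the
  result is the code of the integer \<open>2 ^ n\<close>.\<close>

lemma total_recursive_power: "\<exists>f. total_recursive 1 f \<and> (\<forall>n. f [n] = 2 ^ Suc n)"
proof -
  obtain g where g: "total_recursive 1 g" "\<And>n. g [n] = 2 * n"
    using total_recursive_double by blast
  have "total_recursive (Suc 0) (\<lambda>xs. rec_nat ((\<lambda>_. Suc (Suc 0)) (tl xs))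
      (\<lambda>y r. (\<lambda>xs. g [xs ! 1]) (y # r # tl xs)) (hd xs))"
    by (intro total_recursive.prec total_recursive.zero total_recursive_Suc total_recursive_comp1[OF g(1)]
        total_recursive.proj) simp
  moreover have "rec_nat (Suc (Suc 0)) (\<lambda>y r. 2 * r) n = 2 ^ Suc n" for n :: nat
    by (induction n) auto
  ultimately show ?thesis
    by (intro exI[of _ "\<lambda>xs. rec_nat (Suc (Suc 0)) (\<lambda>y r. 2 * r) (hd xs)"]) (simp add: g(2))
qed

text \<open>Iterated predecessor. The subtrahend comes first because the recursion variable is the
  head of the argument list.\<close>

lemma total_recursive_diff: "\<exists>f. total_recursive 2 f \<and> (\<forall>m n. f [m, n] = n - m)"
proof -
  have "total_recursive (Suc 0) (\<lambda>xs. rec_nat ((\<lambda>_. 0) (tl xs))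
      (\<lambda>y r. (\<lambda>xs. xs ! 0) (y # r # tl xs)) (hd xs))"
    by (intro total_recursive.prec total_recursive.zero total_recursive.proj) simp
  moreover have "rec_nat 0 (\<lambda>y r. y) n = n - 1" for n :: nat
    by (cases n) auto
  ultimately have "total_recursive 1 (\<lambda>xs. hd xs - 1)" by simp
  from total_recursive_comp1[OF this] have pred: "total_recursive k (\<lambda>xs. g xs - 1)"
    if "total_recursive k g" for k g using that by simp
  have "total_recursive (Suc 1) (\<lambda>xs. rec_nat ((\<lambda>xs. xs ! 0) (tl xs))
      (\<lambda>y r. (\<lambda>xs. xs ! 1 - 1) (y # r # tl xs)) (hd xs))"
    by (intro total_recursive.prec total_recursive.proj pred) simp_all
  hence "total_recursive 2 (\<lambda>xs. rec_nat (tl xs ! 0) (\<lambda>y r. r - 1) (hd xs))"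
    by (simp add: numeral_2_eq_2)
  moreover have "rec_nat n (\<lambda>y r. r - 1) m = n - m" for m n :: nat
    by (induction m) auto
  ultimately show ?thesis by (intro exI[of _ "\<lambda>xs. rec_nat (tl xs ! 0) (\<lambda>y r. r - 1) (hd xs)"]) simp
qed

text \<open>With truncated subtraction, \<open>2 ^ (k - m) / 2 ^ k\<close> approximates \<open>1 / 2 ^ m\<close> to within
  \<open>1 / 2 ^ k\<close> also for \<open>k < m\<close>; and \<open>int_encode\<close> doubles nonnegative integers.\<close>

lemma computable_on_inverse_power:
  "computable_on D (\<lambda>q p. 1 / 2 ^ int_poly_encode p)"
proof -
  obtain g where g: "total_recursive 1 g" "\<And>n. g [n] = 2 ^ Suc n"
    using total_recursive_power by blast
  obtain h where h: "total_recursive 2 h" "\<And>m n. h [m, n] = n - m"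
    using total_recursive_diff by blast
  define f where "f = (\<lambda>xs :: nat list. g [h [xs ! 1, xs ! 2]])"
  have "total_recursive 3 f"
    unfolding f_def
    by (intro total_recursive_comp1[OF g(1)] total_recursive_comp2[OF h(1)] total_recursive.proj) simp_all
  moreover have "\<bar>1 / 2 ^ m - of_int (int_decode (f [q, m, k])) / 2 ^ k\<bar> \<le> (1 / 2 ^ k :: real)" for q m k
  proof -
    have "int_encode (2 ^ (k - m)) = f [q, m, k]"
      by (simp add: f_def g(2) h(2) int_encode_def sum_encode_def nat_power_eq)
    hence *: "int_decode (f [q, m, k]) = 2 ^ (k - m)" by (metis int_encode_inverse)
    show ?thesis
    proof (cases "m \<le> k")
      case True
      then obtain j where "k = m + j" by (rule le_Suc_ex[THEN exE])
      thus ?thesis unfolding * by (simp add: power_add)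
    next
      case False
      hence "(2::real) ^ k \<le> 2 ^ m" by (intro power_increasing) auto
      hence "1 / 2 ^ m \<le> (1 / 2 ^ k :: real)" by (intro divide_left_mono) auto
      thus ?thesis unfolding * using False by simp
    qed
  qed
  ultimately show ?thesis unfolding computable_on_def by (intro exI[of _ f]) auto
qed

subsection \<open>Counting\<close>

lemma card_balanced_ge:
  fixes p :: "int poly"
  assumes q: "q \<ge> 2" and d: "degree p \<ge> 2" and lc: "lead_coeff p > 0"
  shows "\<exists>l0\<ge>3. \<forall>l\<ge>l0. \<forall>N\<ge>q ^ (exponent_bound (degree p) * l).
    q ^ (l - 3) \<le> card {n :: nat. 0 < n \<and> n < N \<and> \<not> q dvd n \<and> 0 \<le> poly p (int n) \<and>
      \<bar>real (digit_sum q (nat (poly p (int n)))) - real (digit_sum q n)\<bar> \<le> (real q - 1) / 2}"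
proof -
  obtain e0 where e0: "coeff (pcompose p [:int e, 1:]) i > 0" if "e \<ge> e0" "i \<le> degree p" for e i
    using shifted_coeffs_pos[OF lc] by blast
  \<comment> \<open>Large enough for positive coefficients, and \<open>1\<close> modulo
    \<open>q\<close>; the rest of the argument is divisible by \<open>q\<close>, so \<open>q\<close>
    does not divide \<open>n\<close>.\<close>
  define e where "e = q * e0 + 1"
  define P where "P = pcompose p [:int e, 1:]"
  have degP: "degree P = degree p" by (simp add: P_def degree_pcompose)
  have "1 * e0 \<le> q * e0" using q by (intro mult_le_mono) auto
  hence "e0 \<le> e" unfolding e_def by linarith
  hence P: "coeff P i > 0" if "i \<le> degree P" for i
    using e0 that unfolding degP by (simp add: P_def)
  have Pnn: "coeff P i \<ge> 0" for i
    using P[of i] by (cases "i \<le> degree P") (auto simp: coeff_eq_0)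
  have pP: "poly p (int n) = poly P (int n - int e)" for n
    by (simp add: P_def poly_pcompose)
  \<comment> \<open>Since \<open>l < q ^ l\<close>, a sum of all quantities to be dominated is a
    sufficient threshold.\<close>
  define l0 where "l0 = 3 + digit_sum q e + e + nat (coeff P 1) + nat (poly P 1 * 8 ^ degree P)"
  have "q ^ (l - 3) \<le> card {n :: nat. 0 < n \<and> n < N \<and> \<not> q dvd n \<and> 0 \<le> poly p (int n) \<and>
      \<bar>real (digit_sum q (nat (poly p (int n)))) - real (digit_sum q n)\<bar> \<le> (real q - 1) / 2}"
    (is "_ \<le> card ?A")
    if l: "l \<ge> l0" and N: "N \<ge> q ^ (exponent_bound (degree p) * l)" for l N
  proof -
    have "l < 2 ^ l" by (rule less_exp)
    also have "\<dots> \<le> q ^ l" using q by (intro power_mono) auto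
    finally have lq: "l < q ^ l" .
    have l': "l \<ge> 1" "digit_sum q e \<le> l" "e < q ^ l" "coeff P 1 < int (q ^ l - 1)"
      "poly P 1 * 8 ^ degree P < int (q ^ l)"
      using l lq unfolding l0_def by linarith+
    define M where "M = q ^ l - 1"
    have M: "M > 0" using lq l'(1) by (simp add: M_def)
    have "\<exists>k\<ge>1. k \<le> ((6 * degree P + 1) * (2 * degree P + 1) + 3) * l \<and>
      argument q e (Suc (q * c) * M) k < q ^ (7 * k) \<and>
      2 * \<bar>int (digit_sum q (nat (poly P (int (argument q e (Suc (q * c) * M) k) - int e)))) -
        int (digit_sum q (argument q e (Suc (q * c) * M) k))\<bar> \<le> int q - 1"
      if c: "c < q ^ (l - 3)" for c
      unfolding M_def
    proof (rule exists_balanced_argument[OF q P _ _ _ l'])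
      \<comment> \<open>The multipliers are \<open>Suc (q * c)\<close>, all \<open>1\<close> modulo
        \<open>q\<close>. Of the loss \<open>3\<close> in \<open>l - 3\<close>, one power of
        \<open>q\<close> pays for this spacing and two pay for \<open>4 \<le> q ^ 2\<close>.\<close>
      have "q * (c + 1) \<le> q * q ^ (l - 3)" using c by (intro mult_le_mono) auto
      hence "Suc (q * c) \<le> q * q ^ (l - 3)" using q unfolding distrib_left by linarith
      hence "4 * Suc (q * c) \<le> q ^ 2 * (q * q ^ (l - 3))"
        using power_mono[OF q, of 2] by (intro mult_le_mono) auto
      also have "\<dots> = q ^ (3 + (l - 3))" by (simp add: power_add eval_nat_numeral)
      also have "3 + (l - 3) = l" using l by (simp add: l0_def)
      finally show "3 * Suc (q * c) \<le> q ^ l" by linarith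
    qed (use d degP in auto)
    then obtain k where k: "k c \<ge> 1" "k c \<le> ((6 * degree P + 1) * (2 * degree P + 1) + 3) * l"
      "argument q e (Suc (q * c) * M) (k c) < q ^ (7 * k c)"
      "2 * \<bar>int (digit_sum q (nat (poly P (int (argument q e (Suc (q * c) * M) (k c)) - int e)))) -
        int (digit_sum q (argument q e (Suc (q * c) * M) (k c)))\<bar> \<le> int q - 1"
      if "c < q ^ (l - 3)" for c
      by metis
    define f where "f c = argument q e (Suc (q * c) * M) (k c)" for c
    have "f c \<in> ?A" if c: "c < q ^ (l - 3)" for c
    proof -
      define s where "s = poly seed (int (q ^ k c))"
      have s: "s > 0" unfolding s_def using q by (intro poly_seed_pos) auto
      have fc: "int (f c) = int e + int (Suc (q * c) * M) * int (q ^ k c) * s"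
        unfolding f_def s_def by (rule int_argument[OF q])
      have "0 \<le> int (Suc (q * c) * M) * int (q ^ k c) * s" using s by (intro mult_nonneg_nonneg) auto
      hence fe: "int (f c) \<ge> int e" using fc by linarith
      hence "f c > 0" using e_def by linarith
      moreover have "f c < N"
      proof -
        have "7 * k c \<le> exponent_bound (degree p) * l"
          using k(2)[OF c] unfolding exponent_bound_def degP by linarith
        hence "q ^ (7 * k c) \<le> q ^ (exponent_bound (degree p) * l)"
          using q by (intro power_increasing) auto
        thus ?thesis using k(3)[OF c] N unfolding f_def by linarith
      qed
      moreover have "\<not> q dvd f c"
      proof
        assume "q dvd f c"
        hence "int q dvd int (f c)" by simp
        moreover have "int q dvd int (Suc (q * c) * M) * int (q ^ k c) * s"
          using k(1)[OF c] by (intro dvd_mult2 dvd_mult) (simp add: dvd_power)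
        ultimately have "int q dvd int e" unfolding fc by (metis dvd_add_left_iff)
        hence "q dvd e" by (simp only: int_dvd_int_iff)
        hence "q dvd 1" unfolding e_def by (metis dvd_add_right_iff dvd_triv_left)
        thus False using q by simp
      qed
      moreover have "0 \<le> poly p (int (f c))"
        unfolding pP using fe Pnn by (intro poly_nonneg_of_coeffs) auto
      moreover have "\<bar>real (digit_sum q (nat (poly p (int (f c))))) - real (digit_sum q (f c))\<bar> \<le> (real q - 1) / 2"
      proof -
        have "real_of_int (2 * \<bar>int (digit_sum q (nat (poly p (int (f c))))) - int (digit_sum q (f c))\<bar>)
          \<le> real_of_int (int q - 1)"
          using k(4)[OF c] unfolding pP f_def[symmetric] by (simp only: of_int_le_iff)
        thus ?thesis by simp
      qed
      ultimately show ?thesis by blast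
    qed
    hence "f ` {..<q ^ (l - 3)} \<subseteq> ?A" by blast
    moreover have "inj_on f {..<q ^ (l - 3)}"
    proof (rule inj_onI)
      fix c c' assume c: "c \<in> {..<q ^ (l - 3)}" "c' \<in> {..<q ^ (l - 3)}" "f c = f c'"
      have "Suc (q * i) mod q = 1" for i
        using q mod_mult_self2[of 1 q i] by simp
      hence "Suc (q * c) = Suc (q * c')"
        using c by (intro argument_inj[OF q M k(1) k(1) _ _ c(3)[unfolded f_def]]) auto
      thus "c = c'" using q by simp
    qed
    moreover have "finite ?A" by (rule finite_subset[of _ "{..<N}"]) auto
    ultimately show ?thesis using card_inj_on_le[of f "{..<q ^ (l - 3)}" ?A] by simp
  qed
  moreover have "l0 \<ge> 3" by (simp add: l0_def)
  ultimately show ?thesis by blast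
qed

text \<open>Between \<open>q ^ (E * l)\<close> and \<open>q ^ (E * (l + 1))\<close> the power
  \<open>N powr (1 / E)\<close> is at most \<open>q ^ (l + 1)\<close>, a constant multiple of
  \<open>q ^ (l - m)\<close>.\<close>

lemma bigomega_powrI:
  fixes f :: "nat \<Rightarrow> real"
  assumes q: "q \<ge> 2" and E: "E > 0" and \<gamma>: "0 \<le> \<gamma>" "\<gamma> \<le> 1 / real E"
    and f: "\<forall>l\<ge>l0. \<forall>N\<ge>q ^ (E * l). f N \<ge> real q ^ (l - m)"
    and l0: "l0 \<ge> m"
  shows "f \<in> \<Omega>(\<lambda>N. real N powr \<gamma>)"
proof (rule landau_omega.bigI[of "1 / real q ^ Suc m"])
  show "1 / real q ^ Suc m > 0" using q by simp
  show "\<forall>\<^sub>F N in sequentially. norm (f N) \<ge> 1 / real q ^ Suc m * norm (real N powr \<gamma>)"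
    using eventually_ge_at_top[of "q ^ (E * l0)"]
  proof eventually_elim
    case (elim N)
    have "q ^ 1 \<le> q ^ E" using q E by (intro power_increasing) auto
    hence qE: "2 \<le> q ^ E" using q by simp
    have "0 < q ^ (E * l0)" using q by simp
    hence N1: "1 \<le> N" using elim by linarith
    obtain l where l: "(q ^ E) ^ l \<le> N" "N < (q ^ E) ^ (l + 1)"
      using ex_power_ivl1[OF qE N1] by auto
    have "(q ^ E) ^ l0 < (q ^ E) ^ (l + 1)" using elim l by (simp add: power_mult)
    hence "l0 < l + 1" using qE by (subst (asm) power_strict_increasing_iff) auto
    hence ll: "l0 \<le> l" by simp
    have q0: "real q > 0" using q by simp
    have "real N powr \<gamma> \<le> real N powr (1 / real E)"
      using N1 \<gamma> by (intro powr_mono) auto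
    also have "real N \<le> real q ^ (E * (l + 1))"
      using l(2) by (metis less_imp_le of_nat_le_iff of_nat_power power_mult)
    hence "real N powr (1 / real E) \<le> (real q ^ (E * (l + 1))) powr (1 / real E)"
      by (intro powr_mono2) auto
    also have "\<dots> = real q powr (real (E * (l + 1)) * (1 / real E))"
      using q0 by (simp only: powr_realpow[symmetric] powr_powr)
    also have "real (E * (l + 1)) * (1 / real E) = real (l + 1)" using E by (simp only: of_nat_mult) simp
    also have "real q powr real (l + 1) = real q ^ (Suc m + (l - m))"
      using q0 ll l0 by (subst powr_realpow) auto
    also have "\<dots> \<le> real q ^ Suc m * f N"
      unfolding power_add using f ll l(1) by (intro mult_left_mono) (auto simp: power_mult)
    finally have "1 / real q ^ Suc m * real N powr \<gamma> \<le> f N"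
      using q0 by (simp add: field_simps)
    thus ?case by simp
  qed
qed

theorem theorem1p1:
  "\<exists>\<gamma> :: nat \<Rightarrow> int poly \<Rightarrow> real.
     computable_on {(q, p). q \<ge> 2 \<and> degree p \<ge> 2 \<and> lead_coeff p > 0} \<gamma> \<and>
     (\<forall>(q :: nat) (p :: int poly). q \<ge> 2 \<and> degree p \<ge> 2 \<and> lead_coeff p > 0 \<longrightarrow>
        \<gamma> q p > 0 \<and>
        (\<lambda>N :: nat. real (card {n :: nat. 0 < n \<and> n < N \<and> \<not> q dvd n \<and> 0 \<le> poly p (int n) \<and>
             \<bar>real (digit_sum q (nat (poly p (int n)))) - real (digit_sum q n)\<bar>
               \<le> (real q - 1) / 2}))
          \<in> \<Omega>(\<lambda>N. real N powr \<gamma> q p))"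
proof (intro exI[of _ "\<lambda>q p. 1 / 2 ^ int_poly_encode p"] conjI allI impI computable_on_inverse_power)
  fix q :: nat and p :: "int poly"
  assume "q \<ge> 2 \<and> degree p \<ge> 2 \<and> lead_coeff p > 0"
  hence q: "q \<ge> 2" and d: "degree p \<ge> 2" and lc: "lead_coeff p > 0" by auto
  define A where "A N = card {n :: nat. 0 < n \<and> n < N \<and> \<not> q dvd n \<and> 0 \<le> poly p (int n) \<and>
    \<bar>real (digit_sum q (nat (poly p (int n)))) - real (digit_sum q n)\<bar> \<le> (real q - 1) / 2}" for N
  show "(1 :: real) / 2 ^ int_poly_encode p > 0" by simp
  obtain l0 where l0: "l0 \<ge> 3"
    and A: "\<forall>l\<ge>l0. \<forall>N\<ge>q ^ (exponent_bound (degree p) * l). q ^ (l - 3) \<le> A N"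
    using card_balanced_ge[OF q d lc] unfolding A_def by blast
  have "real (exponent_bound (degree p)) \<le> 2 ^ int_poly_encode p"
    using exponent_bound_le[OF lc d] by (metis of_nat_le_iff of_nat_numeral of_nat_power)
  moreover have pos: "exponent_bound (degree p) > 0" by (simp add: exponent_bound_def)
  \<comment> \<open>The right-hand side is the exponent that the construction yields; the chosen one
    is smaller but easy to compute.\<close>
  ultimately have le: "1 / 2 ^ int_poly_encode p \<le> 1 / real (exponent_bound (degree p))"
    by (intro divide_left_mono) auto
  have "\<forall>l\<ge>l0. \<forall>N\<ge>q ^ (exponent_bound (degree p) * l). real q ^ (l - 3) \<le> real (A N)"
    using A by (metis of_nat_le_iff of_nat_power)
  from bigomega_powrI[OF q pos _ le this l0]
  have "(\<lambda>N. real (A N)) \<in> \<Omega>(\<lambda>N. real N powr (1 / 2 ^ int_poly_encode p))" by simp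
  thus "(\<lambda>N :: nat. real (card {n :: nat. 0 < n \<and> n < N \<and> \<not> q dvd n \<and> 0 \<le> poly p (int n) \<and>
             \<bar>real (digit_sum q (nat (poly p (int n)))) - real (digit_sum q n)\<bar>
               \<le> (real q - 1) / 2}))
          \<in> \<Omega>(\<lambda>N. real N powr (1 / 2 ^ int_poly_encode p))"
    unfolding A_def .
qed

end
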